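(* Let $n\geq 4$ be an integer, let $K$ be a field, $S=K[x_1,\ldots,x_n]$, and let $J_{n,n-2}\subset S$ be the $(n-2)$-path ideal of the cycle graph of length $n$. Then: (1) If $n$ is odd, then $\operatorname{sdepth}(S/J_{n,n-2}^t)=\operatorname{depth}(S/J_{n,n-2}^t)=0$ for all $t\geq \frac{n-1}{2}$. (2) If $n$ is even, then $\operatorname{depth}(S/J_{n,n-2}^t)\leq 1$ for all $t\geq n-1$. (3) If $n$ is even, then $\operatorname{sdepth}(S/J_{n,n-2}^t)\leq \frac{n}{2}$ for all $t\geq n-1$.
   Context: For integers $n>m\geq 2$, the $m$-path ideal of the cycle graph of length $n$ is the monomial ideal $J_{n,m}\subset S$ generated by the $n$ monomials $x_ix_{i+1}\cdots x_{i+m-1}$, $1\leq i\leq n$, where indices are read modulo $n$ in $\{1,\ldots,n\}$. Here $m=n-2$. Depth is taken with respect to the graded maximal ideal $(x_1,\ldots,x_n)$. For a $\mathbb Z^n$-graded $S$-module $M$, a Stanley decomposition $\mathcal D$ of $M$ is a direct sum decomposition $M=\bigoplus_{i=1}^r m_iK[Z_i]$ as a $\mathbb Z^n$-graded $K$-vector space, where each $m_i\in M$ is $\mathbb Z^n$-homogeneous, $Z_i\subset\{x_1,\ldots,x_n\}$, and $m_iK[Z_i]=\{um_i: u\in K[Z_i]\}$ is a free $K[Z_i]$-submodule of $M$. Put $\operatorname{sdepth}(\mathcal D)=\min_i|Z_i|$; the Stanley depth $\operatorname{sdepth}(M)$ is the maximum of $\operatorname{sdepth}(\mathcal D)$ over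 all Stanley decompositions $\mathcal D$ of $M$. *)

theory Defs
  imports
    "HOL-Library.Poly_Mapping"
    "HOL-Library.Extended_Nat"
    "HOL-Algebra.Module"
    "HOL-Algebra.QuotRing"
    "HOL-Algebra.Ideal_Product"
begin

section \<open>Polynomial rings\<close>

text \<open>A polynomial over \<open>'k\<close> in variables indexed by natural numbers is a finitely supported
  map from exponent vectors to coefficients.\<close>

type_synonym 'k mpoly = "(nat \<Rightarrow>\<^sub>0 nat) \<Rightarrow>\<^sub>0 'k"

definition mvar :: "nat \<Rightarrow> 'k::field mpoly"
  where "mvar i = Poly_Mapping.single (Poly_Mapping.single i 1) 1"

text \<open>\<open>poly_ring V\<close> is the ring \<open>K[x\<^sub>i : i \<in> V]\<close>, where the field \<open>K\<close> is the type \<open>'k\<close>. Rings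
  belonging to different sets \<open>V\<close> share their operations, so that \<open>K[Z]\<close> is a subring of \<open>K[V]\<close>
  for \<open>Z \<subseteq> V\<close>.\<close>

definition poly_ring :: "nat set \<Rightarrow> 'k::field mpoly ring"
  where "poly_ring V =
    \<lparr>carrier = {p. \<forall>e\<in>Poly_Mapping.keys p. Poly_Mapping.keys e \<subseteq> V},
     mult = (*), one = 1, zero = 0, add = (+)\<rparr>"

definition max_ideal :: "nat set \<Rightarrow> 'k::field mpoly set"
  where "max_ideal V = genideal (poly_ring V) (mvar ` V)"

text \<open>Indices are read modulo \<open>n\<close> in \<open>{1,\<dots>,n}\<close>; note that \<open>i + k - 1\<close> is not truncated, as \<open>i \<ge> 1\<close>.\<close>

definition cycle_path_ideal :: "nat \<Rightarrow> nat \<Rightarrow> 'k::field mpoly set"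
  where "cycle_path_ideal n m =
    genideal (poly_ring {1..n}) ((\<lambda>i. \<Prod>k<m. mvar ((i + k - 1) mod n + 1)) ` {1..n})"

definition ideal_power :: "('a, 'b) ring_scheme \<Rightarrow> 'a set \<Rightarrow> nat \<Rightarrow> 'a set"
  where "ideal_power R I t = I [^]\<^bsub>ideals_set R\<^esub> t"


section \<open>The quotient of a ring by an ideal as a module\<close>

definition quot_module :: "('a, 'b) ring_scheme \<Rightarrow> 'a set \<Rightarrow> ('a, 'a set) module"
  where "quot_module R I =
    \<lparr>carrier = carrier (R Quot I), mult = mult (R Quot I), one = one (R Quot I),
     zero = zero (R Quot I), add = add (R Quot I),
     smult = (\<lambda>r X. (I +>\<^bsub>R\<^esub> r) \<otimes>\<^bsub>R Quot I\<^esub> X)\<rparr>"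


section \<open>Depth\<close>

definition seq_submodule :: "('a, 'm) module \<Rightarrow> 'a list \<Rightarrow> 'm set"
  where "seq_submodule M fs =
    {\<Oplus>\<^bsub>M\<^esub>i\<in>{..<length fs}. fs ! i \<odot>\<^bsub>M\<^esub> g i | g. g \<in> {..<length fs} \<rightarrow> carrier M}"

text \<open>In the definition below, \<open>fs ! i\<close> is a nonzerodivisor on \<open>M / (f\<^sub>0, \<dots>, f\<^sub>i\<^sub>-\<^sub>1) M\<close>, and
  \<open>M / (f\<^sub>0, \<dots>, f\<^sub>r\<^sub>-\<^sub>1) M \<noteq> 0\<close>.\<close>

definition regular_sequence :: "('a, 'm) module \<Rightarrow> 'a list \<Rightarrow> bool"
  where "regular_sequence M fs \<longleftrightarrow>
    (\<forall>i<length fs. \<forall>x\<in>carrier M. fs ! i \<odot>\<^bsub>M\<^esub> x \<in> seq_submodule M (take i fs)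
        \<longrightarrow> x \<in> seq_submodule M (take i fs)) \<and>
    seq_submodule M fs \<noteq> carrier M"

definition module_depth :: "'a set \<Rightarrow> ('a, 'm) module \<Rightarrow> enat"
  where "module_depth I M = Sup {enat (length fs) | fs. set fs \<subseteq> I \<and> regular_sequence M fs}"


section \<open>Stanley depth\<close>

text \<open>For \<open>V = {1..n}\<close>, the group \<open>\<int>\<^sup>n\<close> is the set of all \<open>a :: nat \<Rightarrow>\<^sub>0 int\<close> with \<open>keys a \<subseteq> V\<close>.
  A grading of a module is the family \<open>G\<close> of its homogeneous components \<open>G a\<close>.\<close>

definition poly_component :: "nat set \<Rightarrow> (nat \<Rightarrow>\<^sub>0 int) \<Rightarrow> 'k::field mpoly set"
  where "poly_component V a =
    {p \<in> carrier (poly_ring V). \<forall>e\<in>Poly_Mapping.keys p.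
       \<forall>i. int (Poly_Mapping.lookup e i) = Poly_Mapping.lookup a i}"

text \<open>The grading induced on \<open>K[V]/I\<close>, for a monomial ideal \<open>I\<close>.\<close>

definition quot_component :: "nat set \<Rightarrow> 'k::field mpoly set \<Rightarrow> (nat \<Rightarrow>\<^sub>0 int) \<Rightarrow> 'k mpoly set set"
  where "quot_component V I a = (\<lambda>p. I +>\<^bsub>poly_ring V\<^esub> p) ` poly_component V a"

definition stanley_space :: "('k::field mpoly, 'm) module \<Rightarrow> 'm \<times> nat set \<Rightarrow> 'm set"
  where "stanley_space M = (\<lambda>(m, Z). (\<lambda>u. u \<odot>\<^bsub>M\<^esub> m) ` carrier (poly_ring Z))"

text \<open>The list \<open>[(m\<^sub>1, Z\<^sub>1), \<dots>, (m\<^sub>r, Z\<^sub>r)]\<close> represents the decomposition \<open>M = \<Oplus>\<^sub>i m\<^sub>i K[Z\<^sub>i]\<close>. Since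
  every \<open>m\<^sub>i\<close> is homogeneous, each summand is a graded subspace of \<open>M\<close>, so that a direct sum of
  the underlying spaces is one of graded spaces.\<close>

definition stanley_decomposition ::
    "nat set \<Rightarrow> ((nat \<Rightarrow>\<^sub>0 int) \<Rightarrow> 'm set) \<Rightarrow> ('k::field mpoly, 'm) module
      \<Rightarrow> ('m \<times> nat set) list \<Rightarrow> bool"
  where "stanley_decomposition V G M ds \<longleftrightarrow>
    (\<forall>(m, Z)\<in>set ds. m \<in> carrier M \<and> (\<exists>a. Poly_Mapping.keys a \<subseteq> V \<and> m \<in> G a) \<and> Z \<subseteq> V \<and>
        (\<forall>u\<in>carrier (poly_ring Z). u \<odot>\<^bsub>M\<^esub> m = \<zero>\<^bsub>M\<^esub> \<longrightarrow> u = 0)) \<and>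
    (\<forall>x\<in>carrier M. \<exists>!v. v \<in> (\<Pi>\<^sub>E i\<in>{..<length ds}. stanley_space M (ds ! i)) \<and>
        x = (\<Oplus>\<^bsub>M\<^esub>i\<in>{..<length ds}. v i))"

definition sdepth_decomposition :: "('m \<times> nat set) list \<Rightarrow> enat"
  where "sdepth_decomposition ds = (INF (m, Z)\<in>set ds. enat (card Z))"

text \<open>For finite \<open>V\<close> and \<open>M \<noteq> 0\<close>, all values are at most \<open>card V\<close>, so that the supremum of a
  nonempty family is a maximum.\<close>

definition sdepth ::
    "nat set \<Rightarrow> ((nat \<Rightarrow>\<^sub>0 int) \<Rightarrow> 'm set) \<Rightarrow> ('k::field mpoly, 'm) module \<Rightarrow> enat"
  where "sdepth V G M = Sup {sdepth_decomposition ds | ds. stanley_decomposition V G M ds}"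


section \<open>Depth and Stanley depth of a quotient of a polynomial ring\<close>

definition quot_depth :: "nat set \<Rightarrow> 'k::field mpoly set \<Rightarrow> enat"
  where "quot_depth V I = module_depth (max_ideal V) (quot_module (poly_ring V) I)"

definition quot_sdepth :: "nat set \<Rightarrow> 'k::field mpoly set \<Rightarrow> enat"
  where "quot_sdepth V I = sdepth V (quot_component V I) (quot_module (poly_ring V) I)"


section \<open>Well-definedness\<close>

lemma poly_ring_simps [simp]:
  "p \<in> carrier (poly_ring V) \<longleftrightarrow> (\<forall>e\<in>Poly_Mapping.keys p. Poly_Mapping.keys e \<subseteq> V)"
  "mult (poly_ring V) = (*)" "one (poly_ring V) = 1"
  "zero (poly_ring V) = 0" "add (poly_ring V) = (+)"
  by (simp_all add: poly_ring_def)

lemma cring_poly_ring: "cring (poly_ring V :: 'k::field mpoly ring)"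
proof -
  let ?R = "poly_ring V :: 'k mpoly ring"
  have add: "p + q \<in> carrier ?R" if "p \<in> carrier ?R" "q \<in> carrier ?R" for p q
    using that Poly_Mapping.keys_add[of p q] unfolding poly_ring_simps by blast
  have mult: "p * q \<in> carrier ?R" if "p \<in> carrier ?R" "q \<in> carrier ?R" for p q
  proof -
    have "Poly_Mapping.keys e \<subseteq> V" if e: "e \<in> Poly_Mapping.keys (p * q)" for e
    proof -
      obtain a b where ab: "a \<in> Poly_Mapping.keys p" "b \<in> Poly_Mapping.keys q" "e = a + b"
        using Poly_Mapping.keys_mult[of p q] e by blast
      hence "Poly_Mapping.keys a \<subseteq> V" "Poly_Mapping.keys b \<subseteq> V"
        using \<open>p \<in> _\<close> \<open>q \<in> _\<close> unfolding poly_ring_simps by blast+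
      thus ?thesis
        using Poly_Mapping.keys_add[of a b] ab(3) by blast
    qed
    thus ?thesis by simp
  qed
  have neg: "- p \<in> carrier ?R" if "p \<in> carrier ?R" for p
    using that by (simp add: Poly_Mapping.in_keys_iff)
  have zero: "0 \<in> carrier ?R" and one: "1 \<in> carrier ?R"
    by simp_all
  note [simp del] = poly_ring_simps(1)
  have "abelian_group ?R"
  proof (rule abelian_groupI)
    show "\<exists>q\<in>carrier ?R. q \<oplus>\<^bsub>?R\<^esub> p = \<zero>\<^bsub>?R\<^esub>" if "p \<in> carrier ?R" for p
      using neg[OF that] by (intro bexI[of _ "- p"]) simp_all
  qed (simp_all add: add zero add_ac)
  moreover have "Group.comm_monoid ?R"
    by (rule comm_monoidI) (simp_all add: mult one mult_ac)
  ultimately show ?thesis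
    by (rule cringI) (simp add: distrib_right)
qed

lemma mvar_in_carrier: "i \<in> V \<Longrightarrow> mvar i \<in> carrier (poly_ring V)"
  by (simp add: mvar_def)

lemma ideal_max_ideal: "ideal (max_ideal V) (poly_ring V)"
  unfolding max_ideal_def
  by (intro ring.genideal_ideal cring.axioms(1) cring_poly_ring) (use mvar_in_carrier in blast)

lemma ideal_cycle_path_ideal:
  assumes "n \<ge> 1"
  shows "ideal (cycle_path_ideal n m) (poly_ring {1..n})"
  unfolding cycle_path_ideal_def
proof (intro ring.genideal_ideal cring.axioms(1) cring_poly_ring image_subsetI)
  fix i
  interpret cring "poly_ring {1..n} :: 'a mpoly ring" by (rule cring_poly_ring)
  have "mvar ((i + k - 1) mod n + 1) \<in> carrier (poly_ring {1..n} :: 'a mpoly ring)" for k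
    by (rule mvar_in_carrier) (use assms in \<open>auto simp: Suc_le_eq\<close>)
  thus "(\<Prod>k<m. mvar ((i + k - 1) mod n + 1)) \<in> carrier (poly_ring {1..n} :: 'a mpoly ring)"
    using one_closed m_closed by (induction m) (simp_all del: poly_ring_simps(1))
qed

lemma ideal_ideal_power:
  assumes "ring R" "ideal I R"
  shows "ideal (ideal_power R I t) R"
proof -
  interpret ring R by fact
  show ?thesis
    unfolding ideal_power_def nat_pow_def
    by (induction t) (simp_all add: ideals_set_def oneideal ideal_prod_is_ideal assms)
qed

lemma module_quot_module:
  assumes "cring R" "ideal I R"
  shows "module R (quot_module R I)"
proof -
  interpret cring R by fact
  interpret ideal I R by fact
  interpret Q: cring "R Quot I" by (rule quotient_is_cring) fact
  have hom: "a_r_coset R I \<in> ring_hom R (R Quot I)" by (rule rcos_ring_hom)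
  have grp: "abelian_group (quot_module R I)"
    by (rule abelian_groupI)
       (use Q.add.m_assoc Q.add.m_comm Q.add.l_inv_ex in \<open>auto simp: quot_module_def\<close>)
  show ?thesis
    by (rule moduleI[OF \<open>cring R\<close> grp])
       (simp_all add: quot_module_def ring_hom_closed[OF hom] ring_hom_add[OF hom]
          ring_hom_mult[OF hom] ring_hom_one[OF hom] Q.l_distr Q.r_distr Q.m_assoc)
qed

end

theory Submission
  imports Defs
begin

(* Every generator of J is the product of all variables divided by the two variables on an edge of the
   cycle. Let t0 = (n - 1) div 2, and let x^w be (x_1 ... x_n)^(t0 - 1) times the (t - t0)-th power of
   a generator. A matching of t0 edges leaves one vertex uncovered if n is odd, and two vertices of
   opposite parity, which may be prescribed, if n is even. Hence, for n odd, x_i x^w lies in J^t for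
   all i; for n even, x_i x_j x^w lies in J^t for all odd i and even j. A count of degrees (for n even,
   of the degree in the odd and in the even variables separately) shows that x^w is not in J^t, and
   for n even that neither is its product with variables of one parity only. So the annihilator of
   x^w in S/J^t is the maximal ideal, respectively (x_odd) (x_even), whose quotient has depth 1;
   and a Stanley space containing x^w can only involve no variables, respectively variables of one
   parity. *)

section \<open>Modules of the form $R/I$ and regular sequences\<close>

lemma quot_module_zero:
  assumes "ideal I R"
  shows "\<zero>\<^bsub>quot_module R I\<^esub> = I +>\<^bsub>R\<^esub> \<zero>\<^bsub>R\<^esub>"
proof -
  interpret ideal I R by fact
  show ?thesis
    using a_rcos_zero[OF assms a_subgroup[THEN subgroup.one_closed]]
    by (simp add: quot_module_def FactRing_def)
qed

lemma quot_module_smult: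
  assumes "ideal I R" "r \<in> carrier R" "p \<in> carrier R"
  shows "r \<odot>\<^bsub>quot_module R I\<^esub> (I +>\<^bsub>R\<^esub> p) = I +>\<^bsub>R\<^esub> (r \<otimes>\<^bsub>R\<^esub> p)"
  using ring_hom_mult[OF ideal.rcos_ring_hom[OF assms(1)] assms(2,3)]
  by (simp add: quot_module_def)

lemma quot_module_carrier: "carrier (quot_module R I) = (\<lambda>p. I +>\<^bsub>R\<^esub> p) ` carrier R"
  by (auto simp: quot_module_def FactRing_def A_RCOSETS_def')

lemma quot_module_finsum:
  fixes R (structure)
  assumes "cring R" "ideal I R" "finite A" "p \<in> A \<rightarrow> carrier R"
  shows "(\<Oplus>\<^bsub>quot_module R I\<^esub>i\<in>A. I +>\<^bsub>R\<^esub> p i) = I +>\<^bsub>R\<^esub> (\<Oplus>\<^bsub>R\<^esub>i\<in>A. p i)"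
proof -
  interpret cring R by fact
  interpret ideal I R by fact
  interpret M: module R "quot_module R I" by (rule module_quot_module) fact+
  have add: "(I +> a) \<oplus>\<^bsub>quot_module R I\<^esub> (I +> b) = I +> (a \<oplus> b)"
    if "a \<in> carrier R" "b \<in> carrier R" for a b
    using ring_hom_add[OF rcos_ring_hom that] by (simp add: quot_module_def)
  show ?thesis
    using assms(3,4)
  proof (induction A)
    case empty
    show ?case by (simp add: quot_module_zero[OF \<open>ideal I R\<close>])
  next
    case (insert x A)
    then have "p \<in> A \<rightarrow> carrier R" "p x \<in> carrier R" by auto
    moreover from this have "(\<lambda>i. I +> p i) \<in> A \<rightarrow> carrier (quot_module R I)"
      "I +> p x \<in> carrier (quot_module R I)"
      by (auto simp: quot_module_carrier)
    ultimately show ?case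
      using insert by (simp add: add finsum_closed)
  qed
qed

lemma quot_module_eq_iff:
  assumes "cring R" "ideal I R" "a \<in> carrier R" "b \<in> carrier R"
  shows "I +>\<^bsub>R\<^esub> a = I +>\<^bsub>R\<^esub> b \<longleftrightarrow> a \<ominus>\<^bsub>R\<^esub> b \<in> I"
  using ring.quotient_eq_iff_same_a_r_cos[OF cring.axioms(1)[OF assms(1)] assms(2-4)] by simp

lemma seq_submodule_Nil:
  assumes "abelian_monoid M"
  shows "seq_submodule M [] = {\<zero>\<^bsub>M\<^esub>}"
  by (simp add: seq_submodule_def abelian_monoid.finsum_empty[OF assms])

lemma seq_submodule_single:
  assumes "module R M" "f \<in> carrier R"
  shows "seq_submodule M [f] = (\<lambda>x. f \<odot>\<^bsub>M\<^esub> x) ` carrier M"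
proof -
  interpret module R M by fact
  have sum: "(\<Oplus>\<^bsub>M\<^esub>i\<in>{..<length [f]}. [f] ! i \<odot>\<^bsub>M\<^esub> g i) = f \<odot>\<^bsub>M\<^esub> g 0"
    if "g 0 \<in> carrier M" for g :: "nat \<Rightarrow> _"
    using that assms(2) by (simp add: lessThan_Suc)
  show ?thesis
  proof (intro equalityI subsetI)
    fix y assume "y \<in> seq_submodule M [f]"
    then obtain g where "g \<in> {..<length [f]} \<rightarrow> carrier M"
      "y = (\<Oplus>\<^bsub>M\<^esub>i\<in>{..<length [f]}. [f] ! i \<odot>\<^bsub>M\<^esub> g i)"
      unfolding seq_submodule_def by blast
    then show "y \<in> (\<lambda>x. f \<odot>\<^bsub>M\<^esub> x) ` carrier M"
      using sum[of g] by (auto simp: Pi_iff)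
  next
    fix y assume "y \<in> (\<lambda>x. f \<odot>\<^bsub>M\<^esub> x) ` carrier M"
    then obtain x where x: "x \<in> carrier M" "y = f \<odot>\<^bsub>M\<^esub> x" by blast
    then show "y \<in> seq_submodule M [f]"
      unfolding seq_submodule_def using sum[of "\<lambda>_. x"] by (auto intro!: exI[of _ "\<lambda>_. x"])
  qed
qed

text \<open>Unfolds the condition at index 0: the empty list generates the zero submodule, so the
  first element is a nonzerodivisor on R/I. Representatives replace cosets so that later arguments
  stay inside the polynomial ring.\<close>

lemma regular_sequence_quot_first:
  fixes R (structure)
  assumes R: "cring R" "ideal I R" and reg: "regular_sequence (quot_module R I) (f # fs)"
    and mem: "f \<in> carrier R" "p \<in> carrier R" "f \<otimes>\<^bsub>R\<^esub> p \<in> I"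
  shows "p \<in> I"
proof -
  interpret cring R by fact
  interpret I: ideal I R by fact
  interpret M: module R "quot_module R I" by (rule module_quot_module) fact+
  have coset: "I +> a = I +> \<zero> \<longleftrightarrow> a \<in> I" if "a \<in> carrier R" for a
    using quot_module_eq_iff[OF R that zero_closed] that by (simp add: a_minus_def)
  have "I +> p \<in> carrier (quot_module R I)"
    using mem by (auto simp: quot_module_carrier)
  moreover have "f \<odot>\<^bsub>quot_module R I\<^esub> (I +> p) = \<zero>\<^bsub>quot_module R I\<^esub>"
    using mem by (simp add: quot_module_smult[OF R(2)] quot_module_zero[OF R(2)] coset)
  ultimately have "I +> p = \<zero>\<^bsub>quot_module R I\<^esub>"
    using reg unfolding regular_sequence_def
    by (force simp: seq_submodule_Nil[OF M.abelian_monoid_axioms])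
  then show ?thesis
    using mem by (simp add: quot_module_zero[OF R(2)] coset)
qed

text \<open>The condition at index 1, again for representatives: \<open>seq_submodule\<close> of
  \<open>[f]\<close> consists of the multiples of f, and the assumed congruence exhibits g p as such
  a multiple modulo I.\<close>

lemma regular_sequence_quot_second:
  fixes R (structure)
  assumes R: "cring R" "ideal I R" and reg: "regular_sequence (quot_module R I) (f # g # fs)"
    and mem: "f \<in> carrier R" "g \<in> carrier R" "p \<in> carrier R" "q \<in> carrier R"
    and eq: "g \<otimes>\<^bsub>R\<^esub> p \<ominus>\<^bsub>R\<^esub> f \<otimes>\<^bsub>R\<^esub> q \<in> I"
  obtains h where "h \<in> carrier R" "p \<ominus>\<^bsub>R\<^esub> f \<otimes>\<^bsub>R\<^esub> h \<in> I"
proof -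
  interpret cring R by fact
  interpret ideal I R by fact
  let ?M = "quot_module R I"
  have sub: "seq_submodule ?M [f] = (\<lambda>x. f \<odot>\<^bsub>?M\<^esub> x) ` carrier ?M"
    by (intro seq_submodule_single[of R] module_quot_module R mem)
  have "g \<odot>\<^bsub>?M\<^esub> (I +> p) = f \<odot>\<^bsub>?M\<^esub> (I +> q)"
    using mem eq by (simp add: quot_module_smult[OF R(2)] quot_module_eq_iff[OF R])
  then have "g \<odot>\<^bsub>?M\<^esub> (I +> p) \<in> seq_submodule ?M [f]"
    using mem by (auto simp: sub quot_module_carrier)
  moreover have "I +> p \<in> carrier ?M"
    using mem by (auto simp: quot_module_carrier)
  moreover have "\<forall>x\<in>carrier ?M. g \<odot>\<^bsub>?M\<^esub> x \<in> seq_submodule ?M [f] \<longrightarrow> x \<in> seq_submodule ?M [f]"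
    using reg unfolding regular_sequence_def by (auto dest: spec[of _ 1])
  ultimately have "I +> p \<in> seq_submodule ?M [f]" by blast
  then obtain h where "h \<in> carrier R" "I +> p = f \<odot>\<^bsub>?M\<^esub> (I +> h)"
    by (auto simp: sub quot_module_carrier)
  then show thesis
    using that mem by (simp add: quot_module_smult[OF R(2)] quot_module_eq_iff[OF R])
qed

section \<open>Ideals of a polynomial ring\<close>

lemma poly_ring_minus:
  assumes "p \<in> carrier (poly_ring V)" "q \<in> carrier (poly_ring V)"
  shows "p \<ominus>\<^bsub>poly_ring V\<^esub> q = p - q"
proof -
  interpret cring "poly_ring V" by (rule cring_poly_ring)
  have "\<ominus>\<^bsub>poly_ring V\<^esub> q = - q"
    using assms by (intro minus_equality) simp_all
  then show ?thesis by (simp add: a_minus_def)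
qed

lemma poly_ring_coset_eq_iff:
  assumes "ideal I (poly_ring V)" "p \<in> carrier (poly_ring V)" "q \<in> carrier (poly_ring V)"
  shows "I +>\<^bsub>poly_ring V\<^esub> p = I +>\<^bsub>poly_ring V\<^esub> q \<longleftrightarrow> p - q \<in> I"
  using quot_module_eq_iff[OF cring_poly_ring assms] poly_ring_minus[OF assms(2,3)] by simp

lemma poly_ring_finsum:
  assumes "finite A" "p \<in> A \<rightarrow> carrier (poly_ring V)"
  shows "(\<Oplus>\<^bsub>poly_ring V\<^esub>i\<in>A. p i) = (\<Sum>i\<in>A. p i)"
proof -
  interpret cring "poly_ring V" by (rule cring_poly_ring)
  note [simp del] = poly_ring_simps(1)
  show ?thesis
    using assms by (induction A) (auto simp: Pi_iff)
qed

text \<open>An upward closed condition on exponents defines a monomial ideal. Combined with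
  minimality of generated ideals, this turns a property of the generators into one of all exponents
  occurring in the ideal.\<close>

lemma ideal_of_exponentsI:
  fixes I :: "'k::field mpoly set"
  assumes "{p. \<forall>e\<in>Poly_Mapping.keys p. Poly_Mapping.keys e \<subseteq> V \<and> P e} = I"
    and up: "\<And>a e. P e \<Longrightarrow> P (a + e)"
  shows "ideal I (poly_ring V)"
proof -
  interpret R: cring "poly_ring V :: 'k mpoly ring" by (rule cring_poly_ring)
  have I: "p \<in> I \<longleftrightarrow> p \<in> carrier (poly_ring V) \<and> (\<forall>e\<in>Poly_Mapping.keys p. P e)" for p
    using assms(1) by auto
  note [simp del] = poly_ring_simps(1)
  have mult: "x * p \<in> I" if "p \<in> I" "x \<in> carrier (poly_ring V)" for p x
  proof -
    have "x * p \<in> carrier (poly_ring V)"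
      using R.m_closed[of x p] that I by simp
    moreover have "P e" if "e \<in> Poly_Mapping.keys (x * p)" for e
      using that \<open>p \<in> I\<close> keys_mult[of x p] up unfolding I by blast
    ultimately show ?thesis unfolding I by blast
  qed
  show ?thesis
  proof (rule idealI)
    show "subgroup I (add_monoid (poly_ring V))"
    proof (rule R.add.subgroupI)
      show "I \<subseteq> carrier (poly_ring V)" using I by auto
      have "0 \<in> I" using I by (simp add: poly_ring_simps(1))
      then show "I \<noteq> {}" by blast
      fix a assume a: "a \<in> I"
      have "\<ominus>\<^bsub>poly_ring V\<^esub> a = \<zero>\<^bsub>poly_ring V\<^esub> \<ominus>\<^bsub>poly_ring V\<^esub> a"
        using a I by (simp add: a_minus_def)
      also have "\<dots> = - a"
        using a I R.zero_closed by (subst poly_ring_minus) auto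
      finally show "\<ominus>\<^bsub>poly_ring V\<^esub> a \<in> I"
        using a I by (simp add: poly_ring_simps(1))
      fix b assume "b \<in> I"
      then show "a \<oplus>\<^bsub>poly_ring V\<^esub> b \<in> I"
        using a I R.a_closed[of a b] Poly_Mapping.keys_add[of a b] by auto
    qed
  qed (use mult in \<open>auto simp: R.ring_axioms mult.commute\<close>)
qed

text \<open>Cancellation in the exponent monoid leaves one contributing pair, so multiplying by a
  monomial shifts coefficients. In the depth bound this reads off the coefficient of h at w.\<close>

lemma lookup_single_times:
  fixes p :: "'a::cancel_comm_monoid_add \<Rightarrow>\<^sub>0 'b::semiring_0"
  shows "Poly_Mapping.lookup (Poly_Mapping.single a c * p) (a + e) = c * Poly_Mapping.lookup p e"
proof -
  have "a + e = a + x \<longleftrightarrow> e = x" for x by simp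
  then show ?thesis
    by (simp add: lookup_mult lookup_single mult_when when_mult)
qed

lemma poly_ring_mono: "Z \<subseteq> V \<Longrightarrow> p \<in> carrier (poly_ring Z) \<Longrightarrow> p \<in> carrier (poly_ring V)"
  by auto

lemma poly_ring_ideal_closed:
  assumes "ideal I (poly_ring V)"
  shows "0 \<in> I" "p \<in> I \<Longrightarrow> q \<in> I \<Longrightarrow> p + q \<in> I" "p \<in> I \<Longrightarrow> q \<in> I \<Longrightarrow> p - q \<in> I"
    "p \<in> I \<Longrightarrow> p \<in> carrier (poly_ring V)"
    "p \<in> I \<Longrightarrow> r \<in> carrier (poly_ring V) \<Longrightarrow> r * p \<in> I"
proof -
  interpret ideal I "poly_ring V" by fact
  show "0 \<in> I" "p \<in> I \<Longrightarrow> q \<in> I \<Longrightarrow> p + q \<in> I"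
    using additive_subgroup.zero_closed[OF is_additive_subgroup]
      additive_subgroup.a_closed[OF is_additive_subgroup, of p q] by simp_all
  show carr: "p \<in> I \<Longrightarrow> p \<in> carrier (poly_ring V)" for p by (rule Icarr)
  show mult: "p \<in> I \<Longrightarrow> r \<in> carrier (poly_ring V) \<Longrightarrow> r * p \<in> I" for p r
    using I_l_closed[of p r] by simp
  show "p - q \<in> I" if "p \<in> I" "q \<in> I"
    using additive_subgroup.a_closed[OF is_additive_subgroup that(1) mult[OF that(2), of "- 1"]]
    by simp
qed

lemma poly_ring_mult_closed:
  assumes "p \<in> carrier (poly_ring V)" "q \<in> carrier (poly_ring V)"
  shows "p * q \<in> carrier (poly_ring V)"
proof -
  interpret cring "poly_ring V" by (rule cring_poly_ring)
  show ?thesis using m_closed[OF assms] by (simp del: poly_ring_simps(1))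
qed

lemma poly_mapping_eq_sum_single:
  "p = (\<Sum>e\<in>Poly_Mapping.keys p. Poly_Mapping.single e (Poly_Mapping.lookup p e))"
  by (rule poly_mapping_eqI)
     (auto simp: lookup_sum lookup_single when_def in_keys_iff sum.delta)

abbreviation mon :: "(nat \<Rightarrow>\<^sub>0 nat) \<Rightarrow> 'k::field mpoly"
  where "mon e \<equiv> Poly_Mapping.single e 1"

abbreviation unit_exp :: "nat \<Rightarrow> nat \<Rightarrow>\<^sub>0 nat"
  where "unit_exp i \<equiv> Poly_Mapping.single i 1"

lemma mon_ideal_up:
  assumes "ideal I (poly_ring V)" "mon e \<in> I" "Poly_Mapping.keys f \<subseteq> V"
  shows "Poly_Mapping.single (f + e) c \<in> I"
proof -
  have "Poly_Mapping.single f c \<in> carrier (poly_ring V)"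
    using assms(3) by simp
  from poly_ring_ideal_closed(5)[OF assms(1,2) this] show ?thesis
    by (simp add: mult_single)
qed

lemma in_ideal_if_keys:
  assumes I: "ideal I (poly_ring V)" and "\<And>e. e \<in> Poly_Mapping.keys p \<Longrightarrow> mon e \<in> I"
  shows "p \<in> I"
proof -
  have "(\<Sum>e\<in>E. Poly_Mapping.single e (Poly_Mapping.lookup p e)) \<in> I"
    if "finite E" "E \<subseteq> Poly_Mapping.keys p" for E
    using that
  proof (induction E)
    case empty
    show ?case using poly_ring_ideal_closed(1)[OF I] by simp
  next
    case (insert e E)
    then show ?case
      using assms(2)[of e] mon_ideal_up[OF I, of e 0]
      by (auto intro!: poly_ring_ideal_closed(2)[OF I])
  qed
  then show ?thesis
    using poly_mapping_eq_sum_single[of p] by (metis finite_keys order_refl)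
qed

section \<open>Bounds on depth and Stanley depth\<close>

text \<open>Directness of the sum is not used: the coefficient of \<open>x\<^sup>w\<close> singles out one summand, and freeness
  of that summand keeps all \<open>x\<^bsup>f+w\<^esup>\<close> with \<open>f\<close> supported in \<open>Z\<close> outside \<open>I\<close>.\<close>

lemma quot_sdepth_le:
  fixes I :: "'k::field mpoly set"
  assumes I: "ideal I (poly_ring V)" and w: "Poly_Mapping.keys w \<subseteq> V"
    and notin: "\<And>p. p \<in> I \<Longrightarrow> w \<notin> Poly_Mapping.keys p"
    and card: "\<And>Z. Z \<subseteq> V \<Longrightarrow> (\<And>f. Poly_Mapping.keys f \<subseteq> Z \<Longrightarrow> (mon (f + w) :: 'k mpoly) \<notin> I) \<Longrightarrow> card Z \<le> k"
  shows "quot_sdepth V I \<le> enat k"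
  unfolding quot_sdepth_def sdepth_def
proof (rule Sup_least, clarify)
  let ?R = "poly_ring V :: 'k mpoly ring"
  let ?M = "quot_module ?R I"
  fix ds
  assume ds: "stanley_decomposition V (quot_component V I) ?M ds"
  define m Z where "m i = fst (ds ! i)" and "Z i = snd (ds ! i)" for i
  have summand: "(\<exists>a. m i \<in> quot_component V I a)" "Z i \<subseteq> V"
    "\<And>u. u \<in> carrier (poly_ring (Z i)) \<Longrightarrow> u \<odot>\<^bsub>?M\<^esub> m i = \<zero>\<^bsub>?M\<^esub> \<Longrightarrow> u = 0"
    if "i < length ds" for i
    using ds nth_mem[OF that] unfolding stanley_decomposition_def m_def Z_def
    by (auto simp: case_prod_unfold)
  have "mon w \<in> carrier ?R" using w by simp
  then have "I +>\<^bsub>?R\<^esub> mon w \<in> carrier ?M"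
    unfolding quot_module_carrier by blast
  moreover have "\<forall>x\<in>carrier ?M. \<exists>!v. v \<in> (\<Pi>\<^sub>E i\<in>{..<length ds}. stanley_space ?M (ds ! i)) \<and>
      x = (\<Oplus>\<^bsub>?M\<^esub>i\<in>{..<length ds}. v i)"
    using ds unfolding stanley_decomposition_def by (rule conjunct2)
  ultimately have "\<exists>!v. v \<in> (\<Pi>\<^sub>E i\<in>{..<length ds}. stanley_space ?M (ds ! i)) \<and>
      I +>\<^bsub>?R\<^esub> mon w = (\<Oplus>\<^bsub>?M\<^esub>i\<in>{..<length ds}. v i)"
    by (rule bspec[rotated])
  from ex1_implies_ex[OF this]
  obtain v where v: "v \<in> (\<Pi>\<^sub>E i\<in>{..<length ds}. stanley_space ?M (ds ! i))"
    and sum_v: "I +>\<^bsub>?R\<^esub> mon w = (\<Oplus>\<^bsub>?M\<^esub>i\<in>{..<length ds}. v i)"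
    by (elim exE conjE)
  have "\<exists>u p a. u \<in> carrier (poly_ring (Z i)) \<and> p \<in> poly_component V a \<and>
      m i = I +>\<^bsub>?R\<^esub> p \<and> v i = u \<odot>\<^bsub>?M\<^esub> (I +>\<^bsub>?R\<^esub> p)" if i: "i < length ds" for i
  proof -
    have "v i \<in> stanley_space ?M (ds ! i)" using v i by auto
    then obtain u where "u \<in> carrier (poly_ring (Z i))" "v i = u \<odot>\<^bsub>?M\<^esub> m i"
      unfolding stanley_space_def m_def Z_def by (auto simp: case_prod_unfold)
    moreover obtain a p where "p \<in> poly_component V a" "m i = I +>\<^bsub>?R\<^esub> p"
      using summand(1)[OF i] unfolding quot_component_def by blast
    ultimately show ?thesis by metis
  qed
  then obtain u p a where dec: "\<And>i. i < length ds \<Longrightarrow> u i \<in> carrier (poly_ring (Z i))"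
    "\<And>i. i < length ds \<Longrightarrow> p i \<in> poly_component V (a i)"
    "\<And>i. i < length ds \<Longrightarrow> m i = I +>\<^bsub>?R\<^esub> p i"
    "\<And>i. i < length ds \<Longrightarrow> v i = u i \<odot>\<^bsub>?M\<^esub> (I +>\<^bsub>?R\<^esub> p i)"
    by metis
  have u: "u i \<in> carrier ?R" if "i < length ds" for i
    using poly_ring_mono[OF summand(2)[OF that] dec(1)[OF that]] .
  have p: "p i \<in> carrier ?R" if "i < length ds" for i
    using dec(2)[OF that] unfolding poly_component_def by blast
  have up: "(\<lambda>i. u i * p i) \<in> {..<length ds} \<rightarrow> carrier ?R"
    using u p poly_ring_mult_closed by blast
  interpret M: module ?R ?M by (intro module_quot_module cring_poly_ring I)
  have "(\<Oplus>\<^bsub>?M\<^esub>i\<in>{..<length ds}. v i) = (\<Oplus>\<^bsub>?M\<^esub>i\<in>{..<length ds}. I +>\<^bsub>?R\<^esub> (u i * p i))"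
    using up dec(4) quot_module_smult[OF I u p]
    by (intro M.finsum_cong') (auto simp: quot_module_carrier Pi_iff simp del: poly_ring_simps(1))
  also have "\<dots> = I +>\<^bsub>?R\<^esub> (\<Sum>i<length ds. u i * p i)"
    using up by (simp add: quot_module_finsum[OF cring_poly_ring I] poly_ring_finsum del: poly_ring_simps(1))
  finally have "I +>\<^bsub>?R\<^esub> mon w = I +>\<^bsub>?R\<^esub> (\<Sum>i<length ds. u i * p i)"
    using sum_v by simp
  moreover have "(\<Sum>i<length ds. u i * p i) \<in> carrier ?R"
    using up keys_sum[of "\<lambda>i. u i * p i" "{..<length ds}"] by (fastforce simp: Pi_iff)
  ultimately have "mon w - (\<Sum>i<length ds. u i * p i) \<in> I"
    using \<open>mon w \<in> carrier ?R\<close> by (simp add: poly_ring_coset_eq_iff[OF I] del: poly_ring_simps(1))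
  \<comment> \<open>The difference has coefficient 0 at w while x^w has coefficient 1, so the sum of
    the lifts has a term at w.\<close>
  from notin[OF this] have "w \<in> Poly_Mapping.keys (\<Sum>i<length ds. u i * p i)"
    by (simp add: in_keys_iff lookup_minus)
  then obtain i where i: "i < length ds" "w \<in> Poly_Mapping.keys (u i * p i)"
    using keys_sum[of "\<lambda>i. u i * p i" "{..<length ds}"] by auto
  then obtain f e where fe: "w = f + e" "f \<in> Poly_Mapping.keys (u i)" "e \<in> Poly_Mapping.keys (p i)"
    using keys_mult[of "u i" "p i"] by blast
  \<comment> \<open>All exponents of p i agree with the degree a i, so p i is a scalar multiple of
    x^e.\<close>
  have "e' = e" if "e' \<in> Poly_Mapping.keys (p i)" for e'
  proof (rule poly_mapping_eqI)
    fix j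
    have "int (Poly_Mapping.lookup e' j) = int (Poly_Mapping.lookup e j)"
      using dec(2)[OF i(1)] that fe(3) unfolding poly_component_def by simp
    then show "Poly_Mapping.lookup e' j = Poly_Mapping.lookup e j" by simp
  qed
  then have "Poly_Mapping.keys (p i) = {e}" using fe(3) by blast
  then have p_eq: "p i = Poly_Mapping.single e (Poly_Mapping.lookup (p i) e)"
    using poly_mapping_eq_sum_single[of "p i"] by simp
  have "card (Z i) \<le> k"
  proof (rule card)
    show "Z i \<subseteq> V" by (rule summand(2)[OF i(1)])
    fix g :: "nat \<Rightarrow>\<^sub>0 nat" assume g: "Poly_Mapping.keys g \<subseteq> Z i"
    show "(mon (g + w) :: 'k mpoly) \<notin> I"
    proof
      assume "(mon (g + w) :: 'k mpoly) \<in> I"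
      from mon_ideal_up[OF I this, of 0]
      have "Poly_Mapping.single (g + w) (Poly_Mapping.lookup (p i) e) \<in> I" by simp
      \<comment> \<open>Since w = f + e, this product is a scalar multiple of x^(g+w). Both f and g
        involve only variables in Z i, so freeness of the summand applies.\<close>
      then have mem: "mon (g + f) * p i \<in> I"
        by (subst p_eq) (simp add: mult_single fe(1) add.assoc)
      have gf: "mon (g + f) \<in> carrier (poly_ring (Z i))"
        using dec(1)[OF i(1)] fe(2) g Poly_Mapping.keys_add[of g f] by auto
      have gfV: "mon (g + f) \<in> carrier ?R"
        by (rule poly_ring_mono[OF summand(2)[OF i(1)] gf])
      have "mon (g + f) \<odot>\<^bsub>?M\<^esub> m i = I +>\<^bsub>?R\<^esub> (mon (g + f) * p i)"
        using quot_module_smult[OF I gfV p[OF i(1)]] dec(3)[OF i(1)] by simp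
      also have "\<dots> = I +>\<^bsub>?R\<^esub> 0"
        using poly_ring_coset_eq_iff[OF I poly_ring_mult_closed[OF gfV p[OF i(1)]], of 0] mem by simp
      also have "\<dots> = \<zero>\<^bsub>?M\<^esub>"
        using quot_module_zero[OF I] by simp
      finally have "mon (g + f) = (0 :: 'k mpoly)"
        by (rule summand(3)[OF i(1) gf])
      then have "Poly_Mapping.keys (mon (g + f) :: 'k mpoly) = {}" by simp
      then show False by simp
    qed
  qed
  then have "enat (card (Z i)) \<le> enat k" by simp
  moreover have "sdepth_decomposition ds \<le> enat (card (Z i))"
    unfolding sdepth_decomposition_def Z_def
    by (rule INF_lower2[OF nth_mem[OF i(1)]]) (simp add: case_prod_unfold)
  ultimately show "sdepth_decomposition ds \<le> enat k" by (rule order_trans[rotated])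
qed

text \<open>Polynomials without constant term form an ideal, because natural exponents cannot
  cancel, and it contains every variable.\<close>

lemma max_ideal_keys:
  assumes "p \<in> max_ideal V" "e \<in> Poly_Mapping.keys p"
  shows "Poly_Mapping.keys e \<subseteq> V" "e \<noteq> 0"
proof -
  let ?I = "{p :: 'a mpoly. \<forall>e\<in>Poly_Mapping.keys p. Poly_Mapping.keys e \<subseteq> V \<and> e \<noteq> 0}"
  have "ideal ?I (poly_ring V)"
  proof (rule ideal_of_exponentsI[OF refl])
    fix a e :: "nat \<Rightarrow>\<^sub>0 nat" assume "e \<noteq> 0"
    then obtain i where "Poly_Mapping.lookup e i \<noteq> 0"
      by (metis lookup_zero poly_mapping_eqI)
    then have "Poly_Mapping.lookup (a + e) i \<noteq> 0" by (simp add: lookup_add)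
    then show "a + e \<noteq> 0" by auto
  qed
  moreover have "unit_exp i \<noteq> 0" for i
    by (metis lookup_single_eq lookup_zero one_neq_zero)
  ultimately have "max_ideal V \<subseteq> ?I"
    unfolding max_ideal_def
    by (intro ring.genideal_minimal cring.axioms(1) cring_poly_ring)
      (auto simp: mvar_def simp del: One_nat_def)
  then show "Poly_Mapping.keys e \<subseteq> V" "e \<noteq> 0"
    using assms by auto
qed

lemma max_ideal_carrier: "p \<in> max_ideal V \<Longrightarrow> p \<in> carrier (poly_ring V)"
  using max_ideal_keys(1) by auto

lemma exponent_split:
  fixes e :: "nat \<Rightarrow>\<^sub>0 nat"
  assumes "i \<in> Poly_Mapping.keys e"
  obtains f where "e = f + unit_exp i" "Poly_Mapping.keys f \<subseteq> Poly_Mapping.keys e"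
proof
  show "e = (e - unit_exp i) + unit_exp i"
    using assms by (intro poly_mapping_eqI) (auto simp: lookup_add lookup_minus lookup_single when_def in_keys_iff)
  show "Poly_Mapping.keys (e - unit_exp i) \<subseteq> Poly_Mapping.keys e"
    by (auto simp: in_keys_iff lookup_minus)
qed

lemma quot_depth_le:
  assumes "\<And>fs. set fs \<subseteq> max_ideal V \<Longrightarrow> regular_sequence (quot_module (poly_ring V) I) fs \<Longrightarrow> length fs \<le> k"
  shows "quot_depth V I \<le> enat k"
  unfolding quot_depth_def module_depth_def using assms by (auto intro!: Sup_least)

text \<open>Each term of an element f of the maximal ideal contains some variable, so f x^w lies in
  I while x^w does not. Hence no such f can start a regular sequence.\<close>

lemma quot_depth_eq_0:
  fixes I :: "'k::field mpoly set"
  assumes I: "ideal I (poly_ring V)" and w: "Poly_Mapping.keys w \<subseteq> V"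
    and notin: "(mon w :: 'k mpoly) \<notin> I"
    and mem: "\<And>i. i \<in> V \<Longrightarrow> (mon (unit_exp i + w) :: 'k mpoly) \<in> I"
  shows "quot_depth V I = 0"
proof -
  have "quot_depth V I \<le> enat 0"
  proof (rule quot_depth_le)
    fix fs
    assume fs: "set fs \<subseteq> max_ideal V" "regular_sequence (quot_module (poly_ring V) I) fs"
    show "length fs \<le> 0"
    proof (cases fs)
      case (Cons f gs)
      then have f: "f \<in> max_ideal V" using fs by simp
      have "f * mon w \<in> I"
      proof (rule in_ideal_if_keys[OF I])
        fix e assume "e \<in> Poly_Mapping.keys (f * mon w)"
        then obtain a where a: "a \<in> Poly_Mapping.keys f" "e = a + w"
          using keys_mult[of f "mon w"] by auto
        then obtain i where i: "i \<in> Poly_Mapping.keys a"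
          using max_ideal_keys(2)[OF f a(1)] by fastforce
        obtain b where b: "a = b + unit_exp i" "Poly_Mapping.keys b \<subseteq> Poly_Mapping.keys a"
          using exponent_split[OF i] .
        have "e = b + (unit_exp i + w)" using a b by (simp add: add.assoc)
        then show "mon e \<in> I"
          using mon_ideal_up[OF I mem[of i], of b 1] i b max_ideal_keys(1)[OF f a(1)] by auto
      qed
      then have "mon w \<in> I"
        using regular_sequence_quot_first[OF cring_poly_ring I, of f gs "mon w"]
          fs(2) max_ideal_carrier[OF f] w Cons by simp
      then show ?thesis using notin by simp
    qed simp
  qed
  then show ?thesis by (simp add: zero_enat_def[symmetric])
qed

lemma split_keys:
  fixes p :: "'a \<Rightarrow>\<^sub>0 'b::comm_monoid_add"
  obtains a b where "p = a + b" "Poly_Mapping.keys a = {e \<in> Poly_Mapping.keys p. P e}"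
    "Poly_Mapping.keys b = {e \<in> Poly_Mapping.keys p. \<not> P e}"
proof
  define part where "part Q = (\<Sum>e\<in>Set.filter Q (Poly_Mapping.keys p). Poly_Mapping.single e (Poly_Mapping.lookup p e))"
    for Q :: "'a \<Rightarrow> bool"
  have look: "Poly_Mapping.lookup (part Q) e = (if Q e then Poly_Mapping.lookup p e else 0)" for Q e
    by (auto simp: part_def lookup_sum lookup_single when_def in_keys_iff sum.delta)
  show "p = part P + part (\<lambda>e. \<not> P e)"
    by (rule poly_mapping_eqI) (simp add: lookup_add look)
  show "Poly_Mapping.keys (part P) = {e \<in> Poly_Mapping.keys p. P e}"
    "Poly_Mapping.keys (part (\<lambda>e. \<not> P e)) = {e \<in> Poly_Mapping.keys p. \<not> P e}"
    by (auto simp: in_keys_iff look split: if_splits)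
qed

text \<open>If \<open>f\<close> is regular on \<open>S/I\<close>, write \<open>f = a + b\<close> and \<open>g = c + d\<close> with \<open>a, c \<in> (A)\<close> and
  \<open>b, d \<in> (B)\<close>. Then \<open>g \<cdot> a x\<^sup>w = f \<cdot> c x\<^sup>w\<close> modulo \<open>I\<close>, so that if \<open>g\<close> is regular modulo \<open>f\<close>, then
  \<open>a x\<^sup>w = f h\<close>. Cancelling \<open>f\<close> shows that \<open>h\<close> agrees with \<open>x\<^sup>w\<close> after multiplication by a
  variable in \<open>A\<close>, and with \<open>0\<close> after multiplication by one in \<open>B\<close>; the coefficient of \<open>x\<^sup>w\<close> in
  \<open>h\<close> cannot do both.\<close>

lemma quot_depth_le_1:
  fixes I :: "'k::field mpoly set"
  assumes I: "ideal I (poly_ring V)" and w: "Poly_Mapping.keys w \<subseteq> V"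
    and V: "V = A \<union> B" "A \<noteq> {}" "B \<noteq> {}"
    and notin: "\<And>p i. p \<in> I \<Longrightarrow> i \<in> V \<Longrightarrow> unit_exp i + w \<notin> Poly_Mapping.keys p"
    and mem: "\<And>i j. i \<in> A \<Longrightarrow> j \<in> B \<Longrightarrow> (mon (unit_exp i + unit_exp j + w) :: 'k mpoly) \<in> I"
  shows "quot_depth V I \<le> 1"
proof -
  \<comment> \<open>\<open>meets S\<close> describes the monomial ideal generated by the variables
    with index in both S and V.\<close>
  define meets where "meets S p \<longleftrightarrow> p \<in> carrier (poly_ring V) \<and>
      (\<forall>e\<in>Poly_Mapping.keys p. Poly_Mapping.keys e \<inter> S \<noteq> {})" for S and p :: "'k mpoly"
  note [simp del] = poly_ring_simps(1)
  have carr: "p \<in> carrier (poly_ring V)" if "meets S p" for S p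
    using that by (simp add: meets_def)
  have meets_prod: "a * b * mon w \<in> I" if ab: "meets A a" "meets B b" for a b
  proof (rule in_ideal_if_keys[OF I])
    fix e assume "e \<in> Poly_Mapping.keys (a * b * mon w)"
    then obtain c d where cd: "c \<in> Poly_Mapping.keys a" "d \<in> Poly_Mapping.keys b" "e = c + d + w"
      using keys_mult[of "a * b" "mon w"] keys_mult[of a b] by fastforce
    then have "Poly_Mapping.keys c \<subseteq> V" "Poly_Mapping.keys d \<subseteq> V"
      using ab by (auto simp: meets_def poly_ring_simps)
    moreover obtain i j where ij: "i \<in> A" "i \<in> Poly_Mapping.keys c" "j \<in> B" "j \<in> Poly_Mapping.keys d"
      using ab cd unfolding meets_def by blast
    moreover obtain c' where c': "c = c' + unit_exp i" "Poly_Mapping.keys c' \<subseteq> Poly_Mapping.keys c"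
      using exponent_split[OF ij(2)] .
    moreover obtain d' where d': "d = d' + unit_exp j" "Poly_Mapping.keys d' \<subseteq> Poly_Mapping.keys d"
      using exponent_split[OF ij(4)] .
    ultimately have "Poly_Mapping.keys (c' + d') \<subseteq> V"
      using Poly_Mapping.keys_add[of c' d'] by blast
    moreover have "e = (c' + d') + (unit_exp i + unit_exp j + w)"
      using cd(3) c' d' by (simp add: ac_simps)
    ultimately show "mon e \<in> I"
      using mon_ideal_up[OF I mem[OF ij(1,3)], of "c' + d'" 1] by simp
  qed
  have split: "\<exists>a b. f = a + b \<and> meets A a \<and> meets B b" if f: "f \<in> max_ideal V" for f :: "'k mpoly"
  proof -
    obtain a b where ab: "f = a + b"
      "Poly_Mapping.keys a = {e \<in> Poly_Mapping.keys f. Poly_Mapping.keys e \<inter> A \<noteq> {}}"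
      "Poly_Mapping.keys b = {e \<in> Poly_Mapping.keys f. \<not> Poly_Mapping.keys e \<inter> A \<noteq> {}}"
      using split_keys[of f "\<lambda>e. Poly_Mapping.keys e \<inter> A \<noteq> {}"] .
    \<comment> \<open>Such a term has no variable from A but is not constant, so V = A \<union> B
      forces a variable from B.\<close>
    have "Poly_Mapping.keys e \<inter> B \<noteq> {}" if "e \<in> Poly_Mapping.keys b" for e
    proof -
      have e: "e \<in> Poly_Mapping.keys f" "Poly_Mapping.keys e \<inter> A = {}" using that ab(3) by auto
      have "Poly_Mapping.keys e \<noteq> {}" using max_ideal_keys(2)[OF f e(1)] by simp
      then show ?thesis using max_ideal_keys(1)[OF f e(1)] e(2) V(1) by blast
    qed
    then have "meets A a" "meets B b"
      using ab max_ideal_keys(1)[OF f] by (auto simp: meets_def poly_ring_simps)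
    then show ?thesis using ab(1) by blast
  qed
  have meets_mvar: "meets S (mon (unit_exp i))" if "i \<in> S" "i \<in> V" for S i
    using that by (simp add: meets_def poly_ring_simps)
  have mon_w: "mon w \<in> carrier (poly_ring V)" using w by (simp add: poly_ring_simps)
  note closed = poly_ring_ideal_closed(2,3,5)[OF I] and mult = poly_ring_mult_closed
  have "quot_depth V I \<le> enat 1"
  proof (rule quot_depth_le, rule ccontr)
    fix fs
    assume fs: "set fs \<subseteq> max_ideal V" and reg: "regular_sequence (quot_module (poly_ring V) I) fs"
      and "\<not> length fs \<le> 1"
    then obtain f g hs where fs_eq: "fs = f # g # hs"
      by (cases fs; cases "tl fs") auto
    then have f: "f \<in> max_ideal V" and g: "g \<in> max_ideal V" using fs by simp_all
    note fg = max_ideal_carrier[OF f] max_ideal_carrier[OF g]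
    obtain a b where ab: "f = a + b" "meets A a" "meets B b" using split[OF f] by blast
    obtain c d where cd: "g = c + d" "meets A c" "meets B d" using split[OF g] by blast
    have aw: "a * mon w \<in> carrier (poly_ring V)" "c * mon w \<in> carrier (poly_ring V)"
      using mult mon_w carr ab cd by blast+
    \<comment> \<open>Expanding (c + d) a - (a + b) c cancels a c; the mixed products a d and c b
      carry x^w into I.\<close>
    have "g * (a * mon w) - f * (c * mon w) = a * d * mon w - c * b * mon w"
      by (simp add: ab(1) cd(1) algebra_simps)
    also have "\<dots> \<in> I"
      using closed(2) meets_prod ab cd by blast
    finally have "g * (a * mon w) \<ominus>\<^bsub>poly_ring V\<^esub> f * (c * mon w) \<in> I"
      using poly_ring_minus[OF mult[OF fg(2) aw(1)] mult[OF fg(1) aw(2)]] by simp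
    then obtain h where h: "h \<in> carrier (poly_ring V)" "a * mon w \<ominus>\<^bsub>poly_ring V\<^esub> f * h \<in> I"
      using regular_sequence_quot_second[OF cring_poly_ring I reg[unfolded fs_eq] fg aw] by auto
    then have afh: "a * mon w - f * h \<in> I"
      using poly_ring_minus[OF aw(1) mult[OF fg(1) h(1)]] by simp
    have cancel: "p \<in> I" if "p \<in> carrier (poly_ring V)" "f * p \<in> I" for p
      using regular_sequence_quot_first[OF cring_poly_ring I reg[unfolded fs_eq] fg(1) that(1)] that(2) by simp
    obtain i j where ij: "i \<in> A" "j \<in> B" "i \<in> V" "j \<in> V" using V by blast
    let ?x = "mon (unit_exp i) :: 'k mpoly" and ?y = "mon (unit_exp j) :: 'k mpoly"
    have xy: "meets A ?x" "meets B ?y" using meets_mvar ij by blast+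
    \<comment> \<open>Modulo I, f (h - x^w) equals -b x^w, which a variable from A carries into I;
      then f is cancelled.\<close>
    have "?x * (h - mon w) \<in> I"
    proof (rule cancel)
      have "h - mon w \<in> carrier (poly_ring V)"
        using poly_ring_minus[OF h(1) mon_w] ring.ring_simprules(4)[OF cring.axioms(1)[OF cring_poly_ring] h(1) mon_w]
        by simp
      then show "?x * (h - mon w) \<in> carrier (poly_ring V)"
        using mult carr[OF xy(1)] by blast
      have "f * (?x * (h - mon w)) = (0 - ?x * (a * mon w - f * h)) - ?x * b * mon w"
        by (simp add: ab(1) algebra_simps)
      also have "\<dots> \<in> I"
        by (rule closed(2)[OF closed(2)[OF poly_ring_ideal_closed(1)[OF I] closed(3)[OF afh carr[OF xy(1)]]]
              meets_prod[OF xy(1) ab(3)]])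
      finally show "f * (?x * (h - mon w)) \<in> I" .
    qed
    then have "Poly_Mapping.lookup (?x * (h - mon w)) (unit_exp i + w) = 0"
      using notin ij(3) by (simp add: in_keys_iff)
    then have "Poly_Mapping.lookup h w = 1"
      by (simp only: lookup_single_times) (simp add: lookup_minus)
    \<comment> \<open>Modulo I, f h equals a x^w, which a variable from B carries into I.\<close>
    moreover have "?y * h \<in> I"
    proof (rule cancel)
      show "?y * h \<in> carrier (poly_ring V)" using mult carr[OF xy(2)] h(1) by blast
      have "f * (?y * h) = a * ?y * mon w - ?y * (a * mon w - f * h)"
        by (simp add: algebra_simps)
      also have "\<dots> \<in> I"
        by (rule closed(2)[OF meets_prod[OF ab(2) xy(2)] closed(3)[OF afh carr[OF xy(2)]]])
      finally show "f * (?y * h) \<in> I" .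
    qed
    then have "Poly_Mapping.lookup (?y * h) (unit_exp j + w) = 0"
      using notin ij(4) by (simp add: in_keys_iff)
    then have "Poly_Mapping.lookup h w = 0"
      by (simp only: lookup_single_times) simp
    ultimately show False by simp
  qed
  then show ?thesis by (simp add: one_enat_def)
qed

section \<open>Powers of path ideals of cycles\<close>

definition weight :: "nat set \<Rightarrow> (nat \<Rightarrow>\<^sub>0 nat) \<Rightarrow> nat"
  where "weight S e = (\<Sum>l\<in>S. Poly_Mapping.lookup e l)"

lemma weight_add: "weight S (a + b) = weight S a + weight S b"
  by (simp add: weight_def lookup_add sum.distrib)

lemma ideal_power_0: "ideal_power R I 0 = carrier R"
  by (simp add: ideal_power_def nat_pow_def ideals_set_def)

lemma ideal_power_Suc: "ideal_power R I (Suc t) = ideal_prod R (ideal_power R I t) I"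
  by (simp add: ideal_power_def nat_pow_def ideals_set_def)

text \<open>The initial factor p allows both uses in \<open>socle_exp_mem\<close>: 1 in the zeroth
  power starts the product over the matching, and s further generators are then appended.\<close>

lemma ideal_power_prod:
  assumes "p \<in> ideal_power (poly_ring V) I s" "\<And>k. k < t \<Longrightarrow> q k \<in> I"
  shows "p * (\<Prod>k<t. q k) \<in> ideal_power (poly_ring V) I (s + t)"
  using assms(2)
proof (induction t)
  case 0
  show ?case using assms(1) by simp
next
  case (Suc t)
  then have "p * (\<Prod>k<t. q k) \<in> ideal_power (poly_ring V) I (s + t)" "q t \<in> I" by simp_all
  then show ?case
    using ideal_prod.prod[of "p * (\<Prod>k<t. q k)" "ideal_power (poly_ring V) I (s + t)" "q t" I "poly_ring V"]
    by (simp add: ideal_power_Suc mult.assoc)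
qed

text \<open>Degrees add over products and a sum introduces no new exponents, so each of the t
  factors contributes at least c.\<close>

lemma weight_ideal_power:
  assumes "\<And>p e. p \<in> I \<Longrightarrow> e \<in> Poly_Mapping.keys p \<Longrightarrow> c \<le> weight S e"
    and "p \<in> ideal_power (poly_ring V) I t" "e \<in> Poly_Mapping.keys p"
  shows "t * c \<le> weight S e"
  using assms(2,3)
proof (induction t arbitrary: p e)
  case (Suc t)
  have "\<forall>e\<in>Poly_Mapping.keys p. Suc t * c \<le> weight S e"
    using Suc.prems(1) unfolding ideal_power_Suc
  proof (induction p rule: ideal_prod.induct)
    case (prod a b)
    show ?case
    proof
      fix e assume "e \<in> Poly_Mapping.keys (a \<otimes>\<^bsub>poly_ring V\<^esub> b)"
      then obtain x y where "e = x + y" "x \<in> Poly_Mapping.keys a" "y \<in> Poly_Mapping.keys b"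
        using keys_mult[of a b] by auto
      then show "Suc t * c \<le> weight S e"
        using Suc.IH[OF prod(1), of x] assms(1)[OF prod(2), of y] by (simp add: weight_add)
    qed
  next
    case (sum a b)
    then show ?case using Poly_Mapping.keys_add[of a b] by fastforce
  qed
  then show ?case using Suc.prems(2) by blast
qed simp

section \<open>Exponents of the path generators and cyclic indexing\<close>

definition path_exp :: "nat \<Rightarrow> nat \<Rightarrow> nat \<Rightarrow> nat \<Rightarrow>\<^sub>0 nat"
  where "path_exp n m i = (\<Sum>k<m. unit_exp ((i + k - 1) mod n + 1))"

lemma prod_mon: "(\<Prod>k\<in>A. mon (f k)) = mon (\<Sum>k\<in>A. f k)"
  by (induction A rule: infinite_finite_induct) (simp_all add: mult_single)

lemma cycle_path_ideal_eq:
  "cycle_path_ideal n m = genideal (poly_ring {1..n}) ((\<lambda>i. mon (path_exp n m i)) ` {1..n})"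
  by (simp add: cycle_path_ideal_def mvar_def prod_mon path_exp_def)

lemma path_exp_keys: "n \<ge> 1 \<Longrightarrow> Poly_Mapping.keys (path_exp n m i) \<subseteq> {1..n}"
  unfolding path_exp_def
  by (rule order_trans[OF keys_sum]) (auto simp: Suc_le_eq)

lemma mon_path_exp_carrier:
  "n \<ge> 1 \<Longrightarrow> mon (path_exp n m i) \<in> carrier (poly_ring {1..n})"
  using path_exp_keys by simp

lemma mon_path_exp_mem:
  assumes "i \<in> {1..n}"
  shows "mon (path_exp n m i) \<in> cycle_path_ideal n m"
proof -
  have "n \<ge> 1" using assms by simp
  have "(\<lambda>i. mon (path_exp n m i)) ` {1..n} \<subseteq> cycle_path_ideal n m"
    unfolding cycle_path_ideal_eq
    using mon_path_exp_carrier[OF \<open>n \<ge> 1\<close>]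
    by (intro ring.genideal_self cring.axioms(1) cring_poly_ring) blast
  then show ?thesis using assms by blast
qed

lemma weight_cycle_path_ideal:
  fixes p :: "'k::field mpoly"
  assumes "\<And>i. i \<in> {1..n} \<Longrightarrow> c \<le> weight S (path_exp n m i)"
    and "p \<in> cycle_path_ideal n m" "e \<in> Poly_Mapping.keys p"
  shows "c \<le> weight S e"
proof -
  let ?I = "{p :: 'k mpoly. \<forall>e\<in>Poly_Mapping.keys p. Poly_Mapping.keys e \<subseteq> {1..n} \<and> c \<le> weight S e}"
  have "ideal ?I (poly_ring {1..n})"
    by (rule ideal_of_exponentsI[OF refl]) (simp add: weight_add)
  moreover have "mon (path_exp n m i) \<in> ?I" if "i \<in> {1..n}" for i
    using assms(1)[OF that] path_exp_keys[of n m i] that by simp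
  ultimately have "cycle_path_ideal n m \<subseteq> ?I"
    unfolding cycle_path_ideal_eq
    by (intro ring.genideal_minimal cring.axioms(1) cring_poly_ring image_subsetI)
  then show ?thesis using assms(2,3) by blast
qed

lemma cyclic_inj:
  fixes i :: nat
  assumes "1 \<le> i" "a < n" "b < n" "(i + a - 1) mod n = (i + b - 1) mod n"
  shows "a = b"
proof -
  have "y \<le> x" if "x < n" "y < n" "(i + x - 1) mod n = (i + y - 1) mod n" for x y
  proof (rule ccontr)
    assume "\<not> y \<le> x"
    then have "n dvd (i + y - 1) - (i + x - 1)"
      using that(3) by (subst mod_eq_dvd_iff_nat[symmetric]) auto
    then have "n dvd y - x" using assms(1) \<open>\<not> y \<le> x\<close> by simp
    then show False using \<open>\<not> y \<le> x\<close> that(2) by (auto dest: dvd_imp_le)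
  qed
  from this[of a b] this[of b a] show ?thesis using assms by simp
qed

text \<open>The number (l + n - i) mod n is the clockwise distance from i to l; adding n before
  subtracting avoids truncation.\<close>

lemma cyclic_surj:
  fixes i :: nat
  assumes "i \<in> {1..n}" "l \<in> {1..n}"
  shows "l = (i + (l + n - i) mod n - 1) mod n + 1"
proof -
  have "(i + (l + n - i) mod n - 1) mod n = ((i - 1) + (l + n - i) mod n) mod n"
    using assms by simp
  also have "\<dots> = ((i - 1) + (l + n - i)) mod n" by (simp add: mod_add_right_eq)
  also have "(i - 1) + (l + n - i) = (l - 1) + n" using assms by auto
  also have "\<dots> mod n = (l - 1) mod n" by (rule mod_add_self2)
  also have "\<dots> = l - 1" using assms by auto
  finally show ?thesis using assms by simp
qed

text \<open>Positions below n along the cycle are distinct vertices, so for m \<le> n the path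
  monomial is squarefree.\<close>

lemma lookup_path_exp:
  assumes "1 \<le> i" "k < n" "m \<le> n"
  shows "Poly_Mapping.lookup (path_exp n m i) ((i + k - 1) mod n + 1) = (if k < m then 1 else 0)"
proof -
  have "Poly_Mapping.lookup (path_exp n m i) ((i + k - 1) mod n + 1) = (\<Sum>a<m. if a = k then 1 else 0)"
    unfolding path_exp_def lookup_sum
    by (intro sum.cong refl) (use assms cyclic_inj[of i _ n k] in \<open>auto simp: lookup_single when_def\<close>)
  then show ?thesis by simp
qed

text \<open>The generator starting at \<open>after_edge n u\<close> is the product of all variables except the two
  on the edge from \<open>u\<close> to its successor.\<close>

definition after_edge :: "nat \<Rightarrow> nat \<Rightarrow> nat"
  where "after_edge n u = (u + 1) mod n + 1"

text \<open>Counted from i = \<open>after_edge n u\<close>, the path occupies the positions below n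
  - 2, while u and its successor sit at positions n - 2 and n - 1.\<close>

lemma lookup_path_after_edge:
  assumes n: "n \<ge> 2" and u: "u \<in> {1..n}" and l: "l \<in> {1..n}"
  shows "Poly_Mapping.lookup (path_exp n (n - 2) (after_edge n u)) l =
    (if l = u \<or> l = u mod n + 1 then 0 else 1)"
proof -
  define i where "i = after_edge n u"
  define k where "k = (l + n - i) mod n"
  have i: "i \<in> {1..n}" using n by (auto simp: i_def after_edge_def Suc_le_eq)
  have l_eq: "l = (i + k - 1) mod n + 1" using cyclic_surj[OF i l] by (simp add: k_def)
  have k: "k < n" using n by (simp add: k_def)
  have "(i + (n - 2) - 1) mod n = ((u + 1) mod n + (n - 2)) mod n"
    using n by (simp add: i_def after_edge_def)
  also have "\<dots> = (u + 1 + (n - 2)) mod n" by (rule mod_add_left_eq)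
  also have "u + 1 + (n - 2) = u - 1 + n" using n u by auto
  also have "\<dots> mod n = (u - 1) mod n" by (rule mod_add_self2)
  also have "\<dots> = u - 1" using u by auto
  finally have u1: "u = (i + (n - 2) - 1) mod n + 1"
    using n u by simp
  have "(i + (n - 1) - 1) mod n = ((u + 1) mod n + (n - 1)) mod n"
    using n by (simp add: i_def after_edge_def)
  also have "\<dots> = (u + 1 + (n - 1)) mod n" by (rule mod_add_left_eq)
  also have "u + 1 + (n - 1) = u + n" using n by simp
  also have "\<dots> mod n = u mod n" by (rule mod_add_self2)
  finally have u2: "u mod n + 1 = (i + (n - 1) - 1) mod n + 1" by simp
  have "l = u \<longleftrightarrow> k = n - 2"
    using cyclic_inj[of i k n "n - 2"] l_eq u1 i k n by auto
  moreover have "l = u mod n + 1 \<longleftrightarrow> k = n - 1"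
    using cyclic_inj[of i k n "n - 1"] l_eq u2 i k n by auto
  ultimately have "(l = u \<or> l = u mod n + 1) \<longleftrightarrow> \<not> k < n - 2"
    using k n by auto
  then show ?thesis
    using lookup_path_exp[of i k n "n - 2"] i k l_eq by (simp add: i_def)
qed

lemma after_edge_surj:
  assumes n: "n \<ge> 2" and i: "i \<in> {1..n}"
  obtains u where "u \<in> {1..n}" "i = after_edge n u"
proof
  \<comment> \<open>The vertex at position n - 2 from i; two more steps return to i.\<close>
  define u where "u = (i + (n - 2) - 1) mod n + 1"
  show "u \<in> {1..n}" using n by (auto simp: u_def Suc_le_eq)
  have "(u + 1) mod n = ((i + (n - 2) - 1) mod n + 2) mod n" by (simp add: u_def)
  also have "\<dots> = (i + (n - 2) - 1 + 2) mod n" by (rule mod_add_left_eq)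
  also have "i + (n - 2) - 1 + 2 = i - 1 + n" using n i by auto
  also have "(i - 1 + n) mod n = (i - 1) mod n" by (rule mod_add_self2)
  also have "\<dots> = i - 1" using i by auto
  finally show "i = after_edge n u" using i by (simp add: after_edge_def)
qed

section \<open>Degrees of the generators in all variables and in one parity class\<close>

lemma weight_path_exp:
  assumes n: "n \<ge> 2" and i: "i \<in> {1..n}" and S: "S \<subseteq> {1..n}"
  obtains u where "u \<in> {1..n}" "weight S (path_exp n (n - 2) i) = card (S - {u, u mod n + 1})"
proof -
  obtain u where u: "u \<in> {1..n}" "i = after_edge n u"
    using after_edge_surj[OF n i] .
  have "finite S" using S finite_subset by blast
  have "weight S (path_exp n (n - 2) i) = (\<Sum>l\<in>S. if l \<in> {u, u mod n + 1} then 0 else 1)"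
    unfolding weight_def using S by (intro sum.cong) (auto simp: u(2) lookup_path_after_edge[OF n u(1)])
  also have "\<dots> = (\<Sum>l\<in>S - {u, u mod n + 1}. 1)"
    using \<open>finite S\<close> by (intro sum.mono_neutral_cong_right) auto
  finally show thesis using that u(1) by simp
qed

definition parity_class :: "nat \<Rightarrow> bool \<Rightarrow> nat set"
  where "parity_class n b = {l \<in> {1..n}. even l = b}"

lemma card_parity_class:
  assumes "even n"
  shows "card (parity_class n b) = n div 2"
proof -
  obtain N where N: "n = 2 * N" using assms by blast
  have "parity_class n b = (\<lambda>k. if b then 2 * k else 2 * k - 1) ` {1..N}"
  proof (intro equalityI subsetI)
    fix l assume "l \<in> parity_class n b"
    \<comment> \<open>(l + 1) div 2 inverts both k \<mapsto> 2k and k \<mapsto> 2k - 1.\<close>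
    then show "l \<in> (\<lambda>k. if b then 2 * k else 2 * k - 1) ` {1..N}"
      by (intro image_eqI[of _ _ "(l + 1) div 2"]) (auto simp: parity_class_def N, presburger+)
  qed (auto simp: parity_class_def N split: if_splits)
  moreover have "inj_on (\<lambda>k. if b then 2 * k else 2 * k - 1 :: nat) {1..N}"
    by (auto simp: inj_on_def split: if_splits)
  ultimately have "card (parity_class n b) = card {1..N}" by (simp only: card_image)
  then show ?thesis by (simp add: N)
qed

text \<open>For even n, parity alternates along the whole cycle, including the edge from n to 1. So
  every edge has exactly one vertex of the given parity, and each generator omits exactly one
  variable of the class.\<close>

lemma weight_path_exp_parity:
  assumes n: "n \<ge> 2" "even n" and i: "i \<in> {1..n}"
  shows "weight (parity_class n b) (path_exp n (n - 2) i) = n div 2 - 1"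
proof -
  have S: "parity_class n b \<subseteq> {1..n}" by (auto simp: parity_class_def)
  obtain u where u: "u \<in> {1..n}"
    "weight (parity_class n b) (path_exp n (n - 2) i) = card (parity_class n b - {u, u mod n + 1})"
    using weight_path_exp[OF n(1) i S] .
  define v where "v = (if even u = b then u else u mod n + 1)"
  have "even (u mod n + 1) = odd u" "u mod n + 1 \<in> {1..n}"
    using n u by (auto simp: dvd_mod_iff Suc_le_eq)
  then have "v \<in> parity_class n b" "parity_class n b - {u, u mod n + 1} = parity_class n b - {v}"
    using u(1) by (auto simp: v_def parity_class_def)
  then show ?thesis by (simp add: u(2) card_parity_class[OF n(2)])
qed

lemma weight_path_exp_all:
  assumes n: "n \<ge> 2" and i: "i \<in> {1..n}"
  shows "weight {1..n} (path_exp n (n - 2) i) = n - 2"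
proof -
  obtain u where u: "u \<in> {1..n}"
    "weight {1..n} (path_exp n (n - 2) i) = card ({1..n} - {u, u mod n + 1})"
    using weight_path_exp[OF n i order_refl] .
  have "u \<noteq> u mod n + 1" using n u(1) by (cases "u = n") auto
  have "{u, u mod n + 1} \<subseteq> {1..n}" using n u(1) by (auto simp: Suc_le_eq)
  then have "card ({1..n} - {u, u mod n + 1}) = card {1..n} - card {u, u mod n + 1}"
    by (intro card_Diff_subset) simp_all
  then show ?thesis using \<open>u \<noteq> u mod n + 1\<close> u(2) by simp
qed

section \<open>Matchings of the cycle with prescribed uncovered vertices\<close>

text \<open>The odd parameter \<open>d\<close> is the clockwise distance from one uncovered vertex to the other. For odd
  \<open>n\<close>, the choice \<open>d = n\<close> makes the two coincide.\<close>

lemma near_perfect_cover: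
  fixes n d i :: nat
  assumes n: "n \<ge> 3" and i: "i \<in> {1..n}" and d: "odd d" "d \<le> n" "odd n \<longrightarrow> d = n"
  obtains u where "\<forall>k. u k \<in> {1..n}"
    "\<forall>l\<in>{1..n}. l \<noteq> i \<longrightarrow> l \<noteq> (i + d - 1) mod n + 1 \<longrightarrow>
       (\<exists>k<(n - 1) div 2. l = u k \<or> l = u k mod n + 1)"
proof
  \<comment> \<open>Distances are read clockwise from i. The k-th edge starts at an odd distance
    below d or, after jumping over d, at an even distance above it; the gaps on both sides of d
    contain an even number of vertices.\<close>
  define r where "r k = (if 2 * k + 1 < d then 2 * k + 1 else 2 * k + 2)" for k
  define u where "u k = (i + r k - 1) mod n + 1" for k
  show "\<forall>k. u k \<in> {1..n}" using n by (auto simp: u_def Suc_le_eq)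
  show "\<forall>l\<in>{1..n}. l \<noteq> i \<longrightarrow> l \<noteq> (i + d - 1) mod n + 1 \<longrightarrow>
       (\<exists>k<(n - 1) div 2. l = u k \<or> l = u k mod n + 1)"
  proof (intro ballI impI)
    fix l assume l: "l \<in> {1..n}" "l \<noteq> i" "l \<noteq> (i + d - 1) mod n + 1"
    define m where "m = (l + n - i) mod n"
    have l_eq: "l = (i + m - 1) mod n + 1" using cyclic_surj[OF i l(1)] by (simp add: m_def)
    have m: "m < n" "m \<noteq> d" using n l(3) l_eq unfolding m_def by (simp, metis)
    have "m \<noteq> 0"
    proof
      assume "m = 0"
      then have "l = (i - 1) mod n + 1" using l_eq by simp
      also have "(i - 1) mod n = i - 1" using i by (intro mod_less) auto
      also have "i - 1 + 1 = i" using i by simp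
      finally show False using l(2) by simp
    qed
    have "\<exists>k<(n - 1) div 2. m = r k \<or> m = r k + 1"
    proof (cases "m < d")
      case True
      obtain e where e: "d = 2 * e + 1" using d(1) by (elim oddE)
      have "e \<le> (n - 1) div 2" using d(2) e by linarith
      show ?thesis
      proof (cases "even m")
        case True
        then obtain q where q: "m = 2 * q" by (elim evenE)
        have "m = r (q - 1) + 1" "q - 1 < e" using q \<open>m < d\<close> \<open>m \<noteq> 0\<close> e
          by (cases q; simp add: r_def)+
        then show ?thesis using \<open>e \<le> (n - 1) div 2\<close> by (intro exI[of _ "q - 1"]) simp
      next
        case False
        then obtain q where q: "m = 2 * q + 1" by (elim oddE)
        have "m = r q" "q < e" using q \<open>m < d\<close> e by (simp_all add: r_def)
        then show ?thesis using \<open>e \<le> (n - 1) div 2\<close> by (intro exI[of _ "q"]) simp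
      qed
    next
      case False
      then have "d < m" using m(2) by simp
      \<comment> \<open>A vertex at distance beyond d forces d < n, which for odd n is excluded by d
        = n.\<close>
      then have "even n" using d(3) m(1) by auto
      then obtain N where N: "n = 2 * N" by (elim evenE)
      have "(n - 1) div 2 = N - 1" unfolding N by linarith
      show ?thesis
      proof (cases "even m")
        case True
        then obtain q where q: "m = 2 * q" by (elim evenE)
        have "m = r (q - 1)" "q - 1 < N - 1" using q \<open>d < m\<close> m(1) \<open>m \<noteq> 0\<close> N
          by (cases q; simp add: r_def)+
        then show ?thesis unfolding \<open>(n - 1) div 2 = N - 1\<close> by blast
      next
        case False
        then obtain q where q: "m = 2 * q + 1" by (elim oddE)
        obtain e where e: "d = 2 * e + 1" using d(1) by (elim oddE)
        have "e < q" using q e \<open>d < m\<close> by simp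
        then have "m = r (q - 1) + 1" "q - 1 < N - 1" using q e m(1) N
          by (cases q; simp add: r_def)+
        then show ?thesis unfolding \<open>(n - 1) div 2 = N - 1\<close> by blast
      qed
    qed
    then obtain k where k: "k < (n - 1) div 2" "m = r k \<or> m = r k + 1" by blast
    have "u k mod n + 1 = (i + (r k + 1) - 1) mod n + 1"
    proof -
      have "u k mod n = ((i + r k - 1) mod n + 1) mod n" by (simp add: u_def)
      also have "\<dots> = (i + r k - 1 + 1) mod n" by (rule mod_add_left_eq)
      finally show ?thesis using i by simp
    qed
    then show "\<exists>k<(n - 1) div 2. l = u k \<or> l = u k mod n + 1"
      using k l_eq by (auto simp: u_def)
  qed
qed

section \<open>The monomial x^w and its multiples inside and outside the power\<close>

text \<open>For \<open>s = t - \<lfloor>(n - 1) / 2\<rfloor>\<close>, this is the exponent of the monomial of degree just below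
  \<open>J\<^sup>t\<close> whose annihilator modulo \<open>J\<^sup>t\<close> controls depth and Stanley depth.\<close>

definition socle_exp :: "nat \<Rightarrow> nat \<Rightarrow> nat \<Rightarrow>\<^sub>0 nat"
  where "socle_exp n s = (\<Sum>l\<in>{1..n}. Poly_Mapping.single l ((n - 1) div 2 - 1)) +
    (\<Sum>k<s. path_exp n (n - 2) 1)"

lemma socle_exp_keys:
  assumes "n \<ge> 1"
  shows "Poly_Mapping.keys (socle_exp n s) \<subseteq> {1..n}"
proof -
  have "Poly_Mapping.keys (\<Sum>k<s. path_exp n (n - 2) 1) \<subseteq> {1..n}"
    using path_exp_keys[OF assms] by (intro order_trans[OF keys_sum]) blast
  moreover have "Poly_Mapping.keys (\<Sum>l\<in>{1..n}. Poly_Mapping.single l ((n - 1) div 2 - 1)) \<subseteq> {1..n}"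
    by (rule order_trans[OF keys_sum]) (auto split: if_splits)
  ultimately show ?thesis
    unfolding socle_exp_def using Poly_Mapping.keys_add by (meson Un_least order_trans)
qed

lemma weight_socle_exp:
  assumes "S \<subseteq> {1..n}"
  shows "weight S (socle_exp n s) =
    card S * ((n - 1) div 2 - 1) + s * weight S (path_exp n (n - 2) 1)"
proof -
  have "weight S (\<Sum>l\<in>{1..n}. Poly_Mapping.single l c) = card S * c" for c
    using assms by (auto simp: weight_def lookup_sum lookup_single when_def subset_iff)
  moreover have "weight S (\<Sum>k<s. e) = s * weight S e" for e
    unfolding weight_def lookup_sum by (simp add: sum_distrib_left)
  ultimately show ?thesis by (simp add: socle_exp_def weight_add del: sum_constant)
qed

text \<open>Let t0 = (n - 1) div 2. The product x^E of the t0 generators of a near-perfect matching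
  has exponent at most t0 - 1 at a covered vertex and at most t0 at the uncovered ones. The factor
  x^a supplies the missing 1 there, so x^E divides x^a (x_1 ... x_n)^(t0 - 1); the other s
  generators are already part of x^w.\<close>

lemma socle_exp_mem:
  assumes n: "n \<ge> 3" and i: "i \<in> {1..n}" and d: "odd d" "d \<le> n" "odd n \<longrightarrow> d = n"
    and a: "Poly_Mapping.keys a \<subseteq> {1..n}"
      "\<And>l. l = i \<or> l = (i + d - 1) mod n + 1 \<Longrightarrow> Poly_Mapping.lookup a l \<ge> 1"
  shows "(mon (a + socle_exp n s) :: 'k::field mpoly) \<in>
    ideal_power (poly_ring {1..n}) (cycle_path_ideal n (n - 2)) ((n - 1) div 2 + s)"
proof -
  let ?t = "(n - 1) div 2" and ?J = "cycle_path_ideal n (n - 2) :: 'k mpoly set"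
  let ?R = "poly_ring {1..n} :: 'k mpoly ring"
  obtain u where u: "\<forall>k. u k \<in> {1..n}"
    and cover: "\<forall>l\<in>{1..n}. l \<noteq> i \<longrightarrow> l \<noteq> (i + d - 1) mod n + 1 \<longrightarrow>
       (\<exists>k<?t. l = u k \<or> l = u k mod n + 1)"
    using near_perfect_cover[OF n i d] .
  define E where "E = (\<Sum>k<?t. path_exp n (n - 2) (after_edge n (u k)))"
  define F where "F = (\<Sum>l\<in>{1..n}. Poly_Mapping.single l (?t - 1))"
  have after: "after_edge n v \<in> {1..n}" for v
    using n by (auto simp: after_edge_def Suc_le_eq)
  have "mon (E + (\<Sum>k<s. path_exp n (n - 2) 1)) \<in> ideal_power ?R ?J (?t + s)"
  proof -
    have "1 * (\<Prod>k<?t. mon (path_exp n (n - 2) (after_edge n (u k)))) \<in> ideal_power ?R ?J (0 + ?t)"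
      using after by (intro ideal_power_prod mon_path_exp_mem) (simp_all add: ideal_power_0)
    then have "mon E \<in> ideal_power ?R ?J ?t"
      by (simp add: prod_mon E_def)
    then have "mon E * (\<Prod>k<s. mon (path_exp n (n - 2) 1)) \<in> ideal_power ?R ?J (?t + s)"
      using n by (intro ideal_power_prod mon_path_exp_mem) simp_all
    then show ?thesis unfolding prod_mon by (simp add: mult_single)
  qed
  moreover have "Poly_Mapping.keys (a + F - E) \<subseteq> {1..n}"
  proof -
    have "Poly_Mapping.keys F \<subseteq> {1..n}"
      unfolding F_def by (rule order_trans[OF keys_sum]) (auto split: if_splits)
    moreover have "Poly_Mapping.keys (a + F - E) \<subseteq> Poly_Mapping.keys (a + F)"
      by (auto simp: in_keys_iff lookup_minus)
    ultimately show ?thesis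
      using Poly_Mapping.keys_add[of a F] a(1) by blast
  qed
  moreover have "a + socle_exp n s = (a + F - E) + (E + (\<Sum>k<s. path_exp n (n - 2) 1))"
  proof -
    have "Poly_Mapping.lookup E l \<le> Poly_Mapping.lookup (a + F) l" for l
    proof (cases "l \<in> {1..n}")
      case True
      have E: "Poly_Mapping.lookup E l = (\<Sum>k<?t. if l = u k \<or> l = u k mod n + 1 then 0 else 1)"
        unfolding E_def lookup_sum using n u True
        by (intro sum.cong refl lookup_path_after_edge) auto
      have F: "Poly_Mapping.lookup F l = ?t - 1"
        using True by (auto simp: F_def lookup_sum lookup_single when_def)
      show ?thesis
      proof (cases "l = i \<or> l = (i + d - 1) mod n + 1")
        case True
        have "Poly_Mapping.lookup E l \<le> (\<Sum>k<?t. 1)"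
          unfolding E by (intro sum_mono) simp
        then show ?thesis using a(2)[OF True] F by (simp add: lookup_add)
      next
        case False
        then obtain k where k: "k < ?t" "l = u k \<or> l = u k mod n + 1"
          using cover \<open>l \<in> {1..n}\<close> by blast
        \<comment> \<open>The k-th generator omits the variable with index l, so at most t0 - 1
          factors contain it.\<close>
        have "Poly_Mapping.lookup E l = (\<Sum>k\<in>{..<?t} - {k}. if l = u k \<or> l = u k mod n + 1 then 0 else 1)"
          unfolding E using k by (intro sum.mono_neutral_right) auto
        also have "\<dots> \<le> (\<Sum>k\<in>{..<?t} - {k}. 1)" by (intro sum_mono) simp
        also have "\<dots> = ?t - 1" using k(1) by simp
        finally show ?thesis using F by (simp add: lookup_add)
      qed
    next
      case False
      have "Poly_Mapping.keys E \<subseteq> {1..n}"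
        unfolding E_def using n path_exp_keys[of n] by (intro order_trans[OF keys_sum]) auto
      then have "l \<notin> Poly_Mapping.keys E" using False by blast
      then show ?thesis by (simp add: in_keys_iff)
    qed
    then have "(a + F - E) + E = a + F"
      by (intro poly_mapping_eqI) (simp add: lookup_add[of _ E] lookup_minus)
    then show ?thesis
      unfolding socle_exp_def F_def[symmetric] by (simp only: add.assoc[symmetric])
  qed
  moreover have "mon (f + e) \<in> ideal_power ?R ?J (?t + s)"
    if "mon e \<in> ideal_power ?R ?J (?t + s)" "Poly_Mapping.keys f \<subseteq> {1..n}" for e f
  proof (rule mon_ideal_up[OF _ that])
    show "ideal (ideal_power ?R ?J (?t + s)) ?R"
      using n
      by (intro ideal_ideal_power cring.axioms(1) cring_poly_ring ideal_cycle_path_ideal) simp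
  qed
  ultimately show ?thesis by (simp only:)
qed

text \<open>Degrees in S are compared: exponents in the power have degree at least (t0 + s) c, while
  x^w has card S * (t0 - 1) + s c. The s c cancels, which leaves the inequality \<open>lt\<close>.
  The factor x^a may use any variables outside S.\<close>

lemma socle_exp_notin:
  assumes S: "S \<subseteq> {1..n}" and c: "\<And>i. i \<in> {1..n} \<Longrightarrow> weight S (path_exp n (n - 2) i) = c"
    and lt: "card S * ((n - 1) div 2 - 1) < (n - 1) div 2 * c" and n: "n \<ge> 1"
    and a: "weight S a = 0"
    and p: "p \<in> ideal_power (poly_ring {1..n}) (cycle_path_ideal n (n - 2)) ((n - 1) div 2 + s)"
  shows "a + socle_exp n s \<notin> Poly_Mapping.keys p"
proof
  assume "a + socle_exp n s \<in> Poly_Mapping.keys p"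
  moreover have "c \<le> weight S e"
    if "q \<in> cycle_path_ideal n (n - 2)" "e \<in> Poly_Mapping.keys q" for q :: "'a mpoly" and e
    using that by (rule weight_cycle_path_ideal[rotated]) (simp add: c)
  ultimately have "((n - 1) div 2 + s) * c \<le> weight S (a + socle_exp n s)"
    using weight_ideal_power[OF _ p] by blast
  also have "\<dots> = card S * ((n - 1) div 2 - 1) + s * c"
    using weight_socle_exp[OF S] c[of 1] n a by (simp add: weight_add)
  finally show False using lt by (simp add: add_mult_distrib)
qed

section \<open>The criteria applied to odd and to even cycles\<close>

theorem corollary2p8:
  fixes n :: nat and J :: "'k::field mpoly set"
  assumes "n \<ge> 4"
    and "J = cycle_path_ideal n (n - 2)"
  shows "(odd n \<longrightarrow> (\<forall>t \<ge> (n - 1) div 2.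
             quot_sdepth {1..n} (ideal_power (poly_ring {1..n}) J t) = 0 \<and>
             quot_depth {1..n} (ideal_power (poly_ring {1..n}) J t) = 0)) \<and>
         (even n \<longrightarrow> (\<forall>t \<ge> n - 1.
             quot_depth {1..n} (ideal_power (poly_ring {1..n}) J t) \<le> 1)) \<and>
         (even n \<longrightarrow> (\<forall>t \<ge> n - 1.
             quot_sdepth {1..n} (ideal_power (poly_ring {1..n}) J t) \<le> enat (n div 2)))"
proof -
  let ?I = "ideal_power (poly_ring {1..n}) J" and ?t = "(n - 1) div 2"
  have I: "ideal (?I t) (poly_ring {1..n})" for t
    unfolding assms(2) using assms(1)
    by (intro ideal_ideal_power ideal_cycle_path_ideal cring.axioms(1) cring_poly_ring) simp
  note keys = socle_exp_keys[of n]
  have odd: "quot_sdepth {1..n} (?I (?t + s)) = 0 \<and> quot_depth {1..n} (?I (?t + s)) = 0"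
    if n: "odd n" for s
  proof -
    have mem: "mon (unit_exp i + socle_exp n s) \<in> ?I (?t + s)" if "i \<in> {1..n}" for i
    proof -
      \<comment> \<open>The choice d = n makes both uncovered vertices equal to i.\<close>
      have "(i + n - 1) mod n + 1 = i"
        using cyclic_surj[OF that that] that assms(1) by (cases i) auto
      then show ?thesis
        unfolding assms(2) using assms(1) n that
        by (intro socle_exp_mem[of n i n]) auto
    qed
    \<comment> \<open>With n = 2N + 1 the sides are 2N^2 - N - 1 and 2N^2 - N: x^w falls short by a
      single degree.\<close>
    have "card {1..n} * (?t - 1) < ?t * (n - 2)"
    proof -
      obtain N where "n = 2 * N + 1" using n by (elim oddE)
      then obtain M where "n = 2 * M + 5" using assms(1) by (cases N; cases "N - 1") auto
      then show ?thesis by (simp add: algebra_simps)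
    qed
    then have notin: "socle_exp n s \<notin> Poly_Mapping.keys p" if "p \<in> ?I (?t + s)" for p
      using socle_exp_notin[where S = "{1..n}" and a = 0, OF order_refl weight_path_exp_all] that assms
      by (fastforce simp: weight_def)
    have "quot_sdepth {1..n} (?I (?t + s)) \<le> enat 0"
    proof (rule quot_sdepth_le[OF I keys notin])
      fix Z assume Z: "Z \<subseteq> {1..n}"
        "\<And>f. Poly_Mapping.keys f \<subseteq> Z \<Longrightarrow> mon (f + socle_exp n s) \<notin> ?I (?t + s)"
      have "Z = {}"
      proof (rule equals0I)
        fix i assume "i \<in> Z"
        then show False using Z(2)[of "unit_exp i"] mem Z(1) by auto
      qed
      then show "card Z \<le> 0" by simp
    qed (use assms in auto)
    moreover have "quot_depth {1..n} (?I (?t + s)) = 0"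
    proof (rule quot_depth_eq_0[OF I keys _ mem])
      show "mon (socle_exp n s) \<notin> ?I (?t + s)" using notin[of "mon (socle_exp n s)"] by auto
    qed (use assms in auto)
    ultimately show ?thesis by (simp add: zero_enat_def[symmetric])
  qed
  have even: "quot_depth {1..n} (?I (?t + s)) \<le> 1 \<and>
      quot_sdepth {1..n} (?I (?t + s)) \<le> enat (n div 2)" if n: "even n" for s
  proof -
    let ?A = "parity_class n False" and ?B = "parity_class n True"
    have AB: "{1..n} = ?A \<union> ?B" by (auto simp: parity_class_def)
    have mem: "mon (unit_exp i + unit_exp j + socle_exp n s) \<in> ?I (?t + s)"
      if "i \<in> ?A" "j \<in> ?B" for i j
    proof -
      \<comment> \<open>The clockwise distance from i to j; it is odd because the parities of i and
        j differ and n is even.\<close>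
      define d where "d = (j + n - i) mod n"
      have ij: "i \<in> {1..n}" "j \<in> {1..n}" "odd i" "even j"
        using that by (auto simp: parity_class_def)
      have "odd d" "d \<le> n" using n ij assms(1) by (auto simp: d_def dvd_mod_iff)
      moreover have "j = (i + d - 1) mod n + 1"
        using cyclic_surj[OF ij(1,2)] by (simp add: d_def)
      ultimately show ?thesis
        unfolding assms(2) using assms(1) n ij Poly_Mapping.keys_add[of "unit_exp i" "unit_exp j"]
        by (intro socle_exp_mem[of n i d]) (auto simp: lookup_add)
    qed
    \<comment> \<open>With n = 2N the sides are N(N - 2) and (N - 1)^2, again differing by
      1.\<close>
    have lt: "card (parity_class n b) * (?t - 1) < ?t * (n div 2 - 1)" for b
    proof -
      obtain N where "n = 2 * N" using n by (elim evenE)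
      then obtain M where "n = 2 * M + 4" using assms(1) by (cases N; cases "N - 1") auto
      then show ?thesis using card_parity_class[OF n] by (simp add: algebra_simps)
    qed
    have notin: "a + socle_exp n s \<notin> Poly_Mapping.keys p"
      if "p \<in> ?I (?t + s)" "weight (parity_class n b) a = 0" for a p b
    proof (rule socle_exp_notin[where S = "parity_class n b", OF _ weight_path_exp_parity lt _ that(2)])
      show "parity_class n b \<subseteq> {1..n}" by (auto simp: parity_class_def)
    qed (use that assms n in auto)
    have "quot_depth {1..n} (?I (?t + s)) \<le> 1"
    proof (rule quot_depth_le_1[OF I keys AB _ _ _ mem])
      have "1 \<in> ?A" "2 \<in> ?B" using assms(1) by (auto simp: parity_class_def)
      then show "?A \<noteq> {}" "?B \<noteq> {}" by blast+
      fix p i assume "p \<in> ?I (?t + s)"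
      \<comment> \<open>\<open>parity_class n (odd i)\<close> is the class not containing i, so
        multiplying by x_i leaves its degree unchanged.\<close>
      moreover have "weight (parity_class n (odd i)) (unit_exp i) = 0"
        by (auto simp: weight_def lookup_single when_def parity_class_def)
      ultimately show "unit_exp i + socle_exp n s \<notin> Poly_Mapping.keys p" by (rule notin)
    qed (use assms in auto)
    moreover have "quot_sdepth {1..n} (?I (?t + s)) \<le> enat (n div 2)"
    proof (rule quot_sdepth_le[OF I keys])
      show "socle_exp n s \<notin> Poly_Mapping.keys p" if "p \<in> ?I (?t + s)" for p
        using notin[OF that, of True 0] by (simp add: weight_def)
      fix Z assume Z: "Z \<subseteq> {1..n}"
        "\<And>f. Poly_Mapping.keys f \<subseteq> Z \<Longrightarrow> mon (f + socle_exp n s) \<notin> ?I (?t + s)"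
      \<comment> \<open>If Z met both classes, x_i x_j x^w would be a multiple of x^w by variables
        in Z that lies in the power. So Z lies in one class, of size n/2.\<close>
      have "\<not> (i \<in> Z \<and> j \<in> Z)" if "i \<in> ?A" "j \<in> ?B" for i j
        using Z(2)[of "unit_exp i + unit_exp j"] mem[OF that]
          Poly_Mapping.keys_add[of "unit_exp i" "unit_exp j"] by auto
      then obtain b where "Z \<subseteq> parity_class n b"
        using Z(1) AB by blast
      then show "card Z \<le> n div 2"
        using card_mono[of "parity_class n b" Z] card_parity_class[OF n, of b]
        by (simp add: parity_class_def)
    qed (use assms in auto)
    ultimately show ?thesis by blast
  qed
  \<comment> \<open>Every exponent in either range has the form t0 + s, the form treated in
    \<open>odd\<close> and \<open>even\<close>.\<close>
  have "t \<ge> ?t" if "t \<ge> n - 1" for t using that by linarith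
  then show ?thesis
    using odd even by (metis le_Suc_ex)
qed

end
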